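(* Let $\beta_{30},\beta_{21},\beta_{12},\beta_{03},\beta_{40},\beta_{31},\beta_{22},\beta_{13},\beta_{04}$ be real numbers such that the moment matrix $$\mathcal{M}(2)=\begin{pmatrix} 1 &0 & 0 & 1 & 0 & 1 \\ 0 & 1 & 0 & \beta_{30} & \beta_{21} & \beta_{12} \\ 0 &0 & 1 & \beta_{21} & \beta_{12} & \beta_{03} \\ 1& \beta_{30} & \beta_{21} & \beta_{40} & \beta_{31} & \beta_{22} \\ 0 & \beta_{21} & \beta_{12} & \beta_{31} & \beta_{22} & \beta_{13} \\ 1 & \beta_{12} & \beta_{03} & \beta_{22} & \beta_{13} & \beta_{04} \end{pmatrix}$$ is positive semidefinite and invertible. For $u\in\mathbb{R}$ let $\widehat{\mathcal{M}(2)}:=\mathcal{M}(2)-uE_{11}$, where $E_{11}$ is the $6\times 6$ matrix with $(1,1)$ entry equal to $1$ and all other entries equal to $0$. Let $R:=\mathcal{M}(2)^{-1}$, let $R_{11}$ be its $(1,1)$ entry, and let $$u_0:=\frac{1}{R_{11}}=\frac{\det\mathcal{M}(2)}{\det\mathcal{M}(2)_{\{2,3,4,5,6\}}},$$ where $\mathcal{M}(2)_{\{2,3,4,5,6\}}$ is the compression of $\mathcal{M}(2)$ to its last five rows and columns. Then $u_0\ge 0$ and, with $u=u_0$: (i) $\widehat{\mathcal{M}(2)}\ge 0$ (positive semidefinite); (ii) $\operatorname{rank}\widehat{\mathcal{M}(2)}=5$; (iii) $\widehat{\mathcal{M}(2)}$ is recursively generated. Moreover, $u_0$ is the only value of $u\in\mathbb{R}$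 for which $\widehat{\mathcal{M}(2)}$ satisfies (i)--(iii).
   Context: The columns of a $6\times 6$ moment matrix, such as $\mathcal{M}(2)$ or $\widehat{\mathcal{M}(2)}$, are labeled, in order, by the monomials $1,X,Y,X^2,XY,Y^2$. For a real polynomial $p(x,y)=\sum_{i+j\le 2}p_{ij}x^iy^j$ of degree at most $2$, $p(X,Y):=\sum p_{ij}X^iY^j$ denotes the corresponding linear combination of columns of the matrix; a column relation is an identity $p(X,Y)=0$. The matrix is called recursively generated if for every polynomial $p$ (of degree at most $2$) with $p(X,Y)=0$ and every polynomial $q$ with $\deg(pq)\le 2$ one has $(pq)(X,Y)=0$. *)

theory Defs
  imports "HOL-Analysis.Analysis" "HOL-Library.Poly_Mapping"
begin

text \<open>
  Rows and columns are indexed by the numeral type \<open>6\<close>, used 1-based: the indices are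
  \<open>1, 2, 3, 4, 5, 6\<close>, in the order in which \<open>vector\<close> lists its entries
  (as an element of the type, \<open>6\<close> equals \<open>0\<close>). The type \<open>5\<close> is used likewise.
\<close>

definition moment_matrix2 ::
  "real \<Rightarrow> real \<Rightarrow> real \<Rightarrow> real \<Rightarrow> real \<Rightarrow> real \<Rightarrow> real \<Rightarrow> real \<Rightarrow> real \<Rightarrow> real^6^6" where
  "moment_matrix2 \<beta>30 \<beta>21 \<beta>12 \<beta>03 \<beta>40 \<beta>31 \<beta>22 \<beta>13 \<beta>04 = vector [
     vector [1,   0,   0,   1,   0,   1],
     vector [0,   1,   0, \<beta>30, \<beta>21, \<beta>12],
     vector [0,   0,   1, \<beta>21, \<beta>12, \<beta>03],
     vector [1, \<beta>30, \<beta>21, \<beta>40, \<beta>31, \<beta>22],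
     vector [0, \<beta>21, \<beta>12, \<beta>31, \<beta>22, \<beta>13],
     vector [1, \<beta>12, \<beta>03, \<beta>22, \<beta>13, \<beta>04]]"

definition E11 :: "real^6^6" where
  "E11 = (\<chi> i j. if i = 1 \<and> j = 1 then 1 else 0)"

definition compression_23456 :: "real^6^6 \<Rightarrow> real^5^5" where
  "compression_23456 A =
     (let s = (vector [2, 3, 4, 5, 6] :: 6^5) in \<chi> i j. A $ (s $ i) $ (s $ j))"

definition positive_semidefinite :: "real^'n^'n \<Rightarrow> bool" where
  "positive_semidefinite A \<longleftrightarrow> transpose A = A \<and> (\<forall>x. x \<bullet> (A *v x) \<ge> 0)"

text \<open>
  A real polynomial in two variables is given by its finitely supported coefficients:
  \<open>lookup p (i, j)\<close> is the coefficient of \<open>x^i y^j\<close>. Exponents add componentwise, so the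
  product of \<open>Poly_Mapping\<close> is the product of polynomials.
\<close>

type_synonym bipoly = "(nat \<times> nat) \<Rightarrow>\<^sub>0 real"

text \<open>The zero polynomial gets total degree \<open>0\<close>.\<close>

definition total_degree :: "bipoly \<Rightarrow> nat" where
  "total_degree p = Max (insert 0 ((\<lambda>(i, j). i + j) ` Poly_Mapping.keys p))"

text \<open>The exponents of the column labels \<open>1, X, Y, X^2, XY, Y^2\<close>.\<close>

definition column_label :: "6 \<Rightarrow> nat \<times> nat" where
  "column_label k =
     (vector [(0, 0), (1, 0), (0, 1), (2, 0), (1, 1), (0, 2)] :: (nat \<times> nat)^6) $ k"

text \<open>The column combination \<open>p(X,Y)\<close>, meaningful for \<open>p\<close> of total degree at most \<open>2\<close>.\<close>

definition column_combination :: "real^6^6 \<Rightarrow> bipoly \<Rightarrow> real^6" where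
  "column_combination A p =
     (\<Sum>k\<in>UNIV. Poly_Mapping.lookup p (column_label k) *\<^sub>R column k A)"

definition recursively_generated :: "real^6^6 \<Rightarrow> bool" where
  "recursively_generated A \<longleftrightarrow>
     (\<forall>p q. total_degree p \<le> 2 \<longrightarrow> column_combination A p = 0 \<longrightarrow>
        total_degree (p * q) \<le> 2 \<longrightarrow> column_combination A (p * q) = 0)"

end

theory Submission
  imports Defs
begin

text \<open>
  Let \<open>c\<close> be the first column of \<open>M\<^sup>-\<^sup>1\<close>, so that \<open>M c = e\<^sub>1\<close>. Everything is read off from this one vector.
  
  A vector \<open>x\<close> is killed by \<open>M - u E\<^sub>1\<^sub>1\<close> iff \<open>M x = u x\<^sub>1 e\<^sub>1\<close>, that is, iff \<open>x = u x\<^sub>1 c\<close>.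
  Comparing first entries, a nonzero solution forces \<open>u c\<^sub>1 = 1\<close>, and for this \<open>u\<close> the kernel is the line
  spanned by \<open>c\<close> (\<open>kernel_diagonal_perturbation\<close>). As \<open>c\<^sub>1 = R\<^sub>1\<^sub>1\<close>, the rank is \<open>5\<close> at \<open>u = u\<^sub>0\<close> and \<open>6\<close> at
  every other \<open>u\<close>, which yields the rank claim and uniqueness.
  
  Positivity is a Schur complement argument: expanding the quadratic form of \<open>M\<close> at \<open>x - t c\<close> gives
  \<open>x \<bullet> M x - 2 t x\<^sub>1 + t\<^sup>2 c\<^sub>1 \<ge> 0\<close> (\<open>psd_shift\<close>). This shows \<open>c\<^sub>1 > 0\<close>, and with \<open>t = x\<^sub>1 / c\<^sub>1\<close> it becomes
  \<open>x \<bullet> M x \<ge> u\<^sub>0 x\<^sub>1\<^sup>2\<close>. The determinant formula for \<open>u\<^sub>0\<close> is Cramer's rule for \<open>M c = e\<^sub>1\<close>.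
  
  For recursive generation, all column relations of \<open>M - u\<^sub>0 E\<^sub>1\<^sub>1\<close> are multiples of the one with
  coefficients \<open>c\<close>. Under the normalisation of \<open>M\<close>, this polynomial has degree exactly two
  (\<open>inverse_column_quadratic\<close>): a polynomial \<open>c\<^sub>1 + c\<^sub>2 x + c\<^sub>3 y\<close> would need \<open>c\<^sub>1 = 1\<close> and \<open>c\<^sub>2 = c\<^sub>3 = 0\<close> by the first
  three rows, contradicting the row of \<open>x\<^sup>2\<close>. Since degrees add, only constant multiples of
  a relation stay in degree at most two.
\<close>

section \<open>Principal compressions and the diagonal of the inverse\<close>

text \<open>
  In the Leibniz sum, a permutation moving \<open>k\<close> picks a vanishing entry of column \<open>k\<close>.
  The remaining ones permute \<open>- {k}\<close>, and \<open>s\<close> transports the permutations of the smaller index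
  type onto them, preserving signs.
\<close>

lemma det_replace_column_axis:
  fixes A :: "real^'n^'n" and s :: "'m::finite \<Rightarrow> 'n"
  assumes inj: "inj s" and ran: "range s = - {k}"
  shows "det (\<chi> i j. if j = k then axis k 1 $ i else A $ i $ j) = det (\<chi> i j. A $ s i $ s j)"
proof -
  define B :: "real^'n^'n" where "B = (\<chi> i j. if j = k then axis k 1 $ i else A $ i $ j)"
  define t where "t = (\<lambda>p. of_int (sign p) * (\<Prod>i\<in>UNIV. B $ i $ p i))"
  have bij: "bij_betw s UNIV (- {k})"
    using inj ran by (simp add: bij_betw_def)
  have "det B = sum t {p. p permutes UNIV}"
    by (simp add: det_def t_def)
  also have "\<dots> = sum t {p. p permutes (- {k})}"
  proof (rule sum.mono_neutral_right)
    show "\<forall>p\<in>{p. p permutes UNIV} - {p. p permutes (- {k})}. t p = 0"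
    proof
      fix p :: "'n \<Rightarrow> 'n"
      assume p: "p \<in> {p. p permutes UNIV} - {p. p permutes (- {k})}"
      have "p k \<noteq> k"
      proof
        assume "p k = k"
        then have "p permutes (- {k})"
          using p by (auto simp: permutes_def)
        then show False using p by simp
      qed
      moreover obtain i where i: "p i = k"
        using p by (metis DiffD1 mem_Collect_eq permutes_def)
      ultimately have "B $ i $ p i = 0"
        by (auto simp: B_def axis_def)
      then have "(\<Prod>i\<in>UNIV. B $ i $ p i) = 0"
        by (intro prod_zero) auto
      then show "t p = 0" by (simp add: t_def)
    qed
  qed (auto simp: finite_permutations intro: permutes_subset)
  also have "\<dots> = (\<Sum>\<pi>\<in>{\<pi>. \<pi> permutes UNIV}. t (map_permutation UNIV s \<pi>))"
  proof (rule sum.reindex_bij_betw[symmetric])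
    have "map_permutation UNIV s
        = (\<lambda>\<pi> x. if x \<in> - {k} then s (\<pi> (inv_into UNIV s x)) else x)"
      using ran by (auto simp: map_permutation_def restrict_id_def fun_eq_iff)
    then show "bij_betw (map_permutation UNIV s) {\<pi>. \<pi> permutes UNIV} {p. p permutes (- {k})}"
      using bij_betw_permutations[OF bij] by simp
  qed
  also have "\<dots> = (\<Sum>\<pi>\<in>{\<pi>. \<pi> permutes UNIV}.
      of_int (sign \<pi>) * (\<Prod>i\<in>UNIV. A $ s i $ s (\<pi> i)))"
  proof (rule sum.cong[OF refl])
    fix \<pi> :: "'m \<Rightarrow> 'm"
    assume "\<pi> \<in> {\<pi>. \<pi> permutes UNIV}"
    then have \<pi>: "\<pi> permutes UNIV" by simp
    define p where "p = map_permutation UNIV s \<pi>"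
    have ps: "p (s i) = s (\<pi> i)" for i
      unfolding p_def using inj by (simp add: map_permutation_apply)
    have pk: "p k = k"
      unfolding p_def map_permutation_def using ran by simp
    have sk: "s i \<noteq> k" for i using ran by auto
    have "(\<Prod>i\<in>UNIV. B $ i $ p i) = B $ k $ p k * (\<Prod>i\<in>- {k}. B $ i $ p i)"
      by (simp add: prod.remove Compl_eq_Diff_UNIV)
    also have "\<dots> = (\<Prod>i\<in>- {k}. B $ i $ p i)"
      by (simp add: pk B_def axis_def)
    also have "\<dots> = (\<Prod>i\<in>UNIV. B $ s i $ p (s i))"
      by (rule prod.reindex_bij_betw[OF bij, symmetric])
    also have "\<dots> = (\<Prod>i\<in>UNIV. A $ s i $ s (\<pi> i))"
      by (simp add: B_def ps sk)
    finally show "t (map_permutation UNIV s \<pi>)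
        = of_int (sign \<pi>) * (\<Prod>i\<in>UNIV. A $ s i $ s (\<pi> i))"
      using sign_map_permutation[OF inj \<pi>] by (simp add: t_def p_def)
  qed
  also have "\<dots> = det (\<chi> i j. A $ s i $ s j)"
    by (simp add: det_def)
  finally show ?thesis by (simp add: B_def)
qed

lemma matrix_vector_mult_matrix_inv:
  fixes A :: "real^'n^'n"
  assumes "invertible A"
  shows "A *v (matrix_inv A *v b) = b"
  using assms someI_ex[of "\<lambda>B. A ** B = mat 1 \<and> B ** A = mat 1"]
  by (simp add: matrix_inv_def invertible_def matrix_vector_mul_assoc)

text \<open>
  The \<open>k\<close>-th column of the inverse solves \<open>A c = e\<^sub>k\<close>; Cramer's rule for its \<open>k\<close>-th entry
  replaces column \<open>k\<close> of \<open>A\<close> by \<open>e\<^sub>k\<close>.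
\<close>

lemma det_principal_compression:
  fixes A :: "real^'n^'n" and s :: "'m::finite \<Rightarrow> 'n"
  assumes "invertible A" and inj: "inj s" and ran: "range s = - {k}"
  shows "det (\<chi> i j. A $ s i $ s j) = matrix_inv A $ k $ k * det A"
proof -
  define c where "c = matrix_inv A *v axis k 1"
  have Ac: "A *v c = axis k 1"
    unfolding c_def by (rule matrix_vector_mult_matrix_inv) fact
  have "c $ k = matrix_inv A $ k $ k"
    by (simp add: c_def matrix_vector_mult_basis column_def)
  then show ?thesis
    using cramer_lemma[of k A c] det_replace_column_axis[OF inj ran, of A]
    unfolding Ac by simp
qed

section \<open>Kernel, rank and positivity of a diagonal perturbation\<close>

text \<open>
  The kernel is the orthogonal complement of the row space.
\<close>

lemma rank_plus_nullity:
  fixes A :: "real^'n^'m"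
  shows "rank A + dim {x. A *v x = 0} = CARD('n)"
proof -
  have "{x. A *v x = 0} = {y \<in> UNIV. \<forall>x\<in>span (rows A). orthogonal x y}"
  proof (intro set_eqI iffI)
    fix x assume "x \<in> {x. A *v x = 0}"
    then show "x \<in> {y \<in> UNIV. \<forall>x\<in>span (rows A). orthogonal x y}"
      by (auto simp: orthogonal_commute[of _ x] orthogonal_nullspace_rowspace)
  next
    fix x assume x: "x \<in> {y \<in> UNIV. \<forall>x\<in>span (rows A). orthogonal x y}"
    have "(A *v x) $ i = 0" for i
    proof -
      have "row i A \<in> span (rows A)"
        by (rule span_base) (auto simp: rows_def)
      then show ?thesis
        using x by (simp add: orthogonal_def matrix_vector_mul_component row_def vec_lambda_eta)
    qed
    then show "x \<in> {x. A *v x = 0}" by (simp add: vec_eq_iff)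
  qed
  moreover have "dim {y \<in> (UNIV::(real^'n) set). \<forall>x\<in>span (rows A). orthogonal x y}
      + dim (span (rows A)) = dim (UNIV::(real^'n) set)"
    by (rule dim_subspace_orthogonal_to_vectors) auto
  ultimately show ?thesis
    by (simp add: row_rank_def)
qed

text \<open>
  The condition on \<open>x\<close> says that \<open>x\<close> lies in the kernel of \<open>A\<close> with \<open>u\<close> subtracted from its
  \<open>k\<close>-th diagonal entry.
\<close>

lemma kernel_diagonal_perturbation:
  fixes A :: "real^'n^'n"
  assumes "invertible A" and c: "A *v c = axis k 1" and ck: "c $ k \<noteq> 0"
  shows "A *v x = (u * x $ k) *\<^sub>R axis k 1 \<longleftrightarrow> x = 0 \<or> u = 1 / c $ k \<and> x \<in> span {c}"
proof
  assume "A *v x = (u * x $ k) *\<^sub>R axis k 1"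
  then have "A *v x = A *v ((u * x $ k) *\<^sub>R c)"
    by (simp add: matrix_vector_mult_scaleR c)
  then have x: "x = (u * x $ k) *\<^sub>R c"
    using inj_matrix_vector_mult[OF assms(1)] by (simp add: inj_def)
  then have "x $ k = u * x $ k * c $ k"
    by (metis real_scaleR_def vector_scaleR_component)
  moreover have "x = 0" if "x $ k = 0"
    using x that by simp
  ultimately show "x = 0 \<or> u = 1 / c $ k \<and> x \<in> span {c}"
    using x ck by (auto simp: span_singleton field_simps)
next
  assume "x = 0 \<or> u = 1 / c $ k \<and> x \<in> span {c}"
  then show "A *v x = (u * x $ k) *\<^sub>R axis k 1"
    using ck by (auto simp: span_singleton matrix_vector_mult_scaleR c)
qed

text \<open>
  The right-hand side is the quadratic form of \<open>A\<close> at \<open>x - t c\<close>.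
\<close>

lemma psd_shift:
  fixes A :: "real^'n^'n"
  assumes psd: "positive_semidefinite A" and c: "A *v c = axis k 1"
  shows "0 \<le> x \<bullet> (A *v x) - 2 * t * x $ k + t\<^sup>2 * c $ k"
proof -
  have sym: "c \<bullet> (A *v x) = x $ k"
  proof -
    have "c \<bullet> (A *v x) = (transpose A *v c) \<bullet> x"
      by (simp add: dot_lmul_matrix)
    also have "\<dots> = (A *v c) \<bullet> x"
      using psd unfolding positive_semidefinite_def by metis
    finally show ?thesis
      by (simp add: c inner_axis')
  qed
  have "0 \<le> (x - t *\<^sub>R c) \<bullet> (A *v (x - t *\<^sub>R c))"
    using psd by (simp add: positive_semidefinite_def)
  also have "\<dots> = x \<bullet> (A *v x) - 2 * t * x $ k + t\<^sup>2 * c $ k"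
    by (simp add: matrix_vector_mult_diff_distrib matrix_vector_mult_scaleR inner_diff_left
        inner_diff_right c sym inner_axis power2_eq_square algebra_simps)
  finally show ?thesis .
qed

text \<open>
  If \<open>c\<^sub>k\<close> were not positive, the expression of \<open>psd_shift\<close> at \<open>x = e\<^sub>k\<close> would tend to
  \<open>-\<infinity>\<close> as \<open>t\<close> grows.
\<close>

lemma psd_inverse_diagonal_pos:
  fixes A :: "real^'n^'n"
  assumes psd: "positive_semidefinite A" and c: "A *v c = axis k 1"
  shows "0 < c $ k"
proof (rule ccontr)
  assume "\<not> 0 < c $ k"
  \<comment> \<open>At \<open>t = a + 1\<close> the expression is already negative, being at most \<open>a - 2 (a + 1)\<close>.\<close>
  define a where "a = axis k 1 \<bullet> (A *v axis k 1)"
  have a: "0 \<le> a"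
    using psd by (simp add: a_def positive_semidefinite_def)
  have "(a + 1)\<^sup>2 * c $ k \<le> 0"
    using \<open>\<not> 0 < c $ k\<close> by (simp add: mult_nonneg_nonpos)
  then show False
    using psd_shift[OF psd c, of "axis k 1" "a + 1"] a by (simp flip: a_def)
qed

text \<open>
  The optimal choice in \<open>psd_shift\<close> is \<open>t = x\<^sub>k / c\<^sub>k\<close>.
\<close>

lemma psd_quadratic_form_ge:
  fixes A :: "real^'n^'n"
  assumes psd: "positive_semidefinite A" and c: "A *v c = axis k 1"
  shows "(x $ k)\<^sup>2 / c $ k \<le> x \<bullet> (A *v x)"
proof -
  have "0 < c $ k" using psd c by (rule psd_inverse_diagonal_pos)
  then show ?thesis
    using psd_shift[OF psd c, of x "x $ k / c $ k"]
    by (simp add: power2_eq_square field_simps)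
qed

section \<open>Total degree of products\<close>

lemma lookup_times_expand:
  fixes p q :: "'a::monoid_add \<Rightarrow>\<^sub>0 'b::semiring_0"
  shows "Poly_Mapping.lookup (p * q) k
    = (\<Sum>(a, b)\<in>{(a, b). a \<in> Poly_Mapping.keys p \<and> b \<in> Poly_Mapping.keys q \<and> a + b = k}.
        Poly_Mapping.lookup p a * Poly_Mapping.lookup q b)" (is "_ = sum ?f ?S")
proof -
  have "Poly_Mapping.lookup (p * q) k
      = (\<Sum>(a, b). Poly_Mapping.lookup p a * Poly_Mapping.lookup q b when k = a + b)"
    by (simp add: times_poly_mapping.rep_eq prod_fun_unfold_prod)
  also have "\<dots> = (\<Sum>(a, b)\<in>Poly_Mapping.keys p \<times> Poly_Mapping.keys q.
      Poly_Mapping.lookup p a * Poly_Mapping.lookup q b when k = a + b)"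
    by (rule Sum_any.expand_superset) (auto simp: in_keys_iff)
  also have "\<dots> = sum ?f ?S"
    by (rule sum.mono_neutral_cong_right) (auto simp: when_def split: if_splits)
  finally show ?thesis .
qed

lemma total_degree_ge:
  assumes "a \<in> Poly_Mapping.keys p"
  shows "fst a + snd a \<le> total_degree p"
  unfolding total_degree_def using assms
  by (intro Max_ge) (auto simp: case_prod_beta)

text \<open>
  Among the monomials of top degree, the one with the largest power of \<open>x\<close> is the leading
  monomial for the graded lexicographic order.
\<close>

lemma total_degree_leading_monomial:
  assumes "p \<noteq> 0"
  obtains a where "a \<in> Poly_Mapping.keys p" and "fst a + snd a = total_degree p"
    and "\<And>a'. a' \<in> Poly_Mapping.keys p \<Longrightarrow> fst a' + snd a' = total_degree p \<Longrightarrow> fst a' \<le> fst a"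
proof -
  define T where "T = {a \<in> Poly_Mapping.keys p. fst a + snd a = total_degree p}"
  have "total_degree p \<in> insert 0 ((\<lambda>(i, j). i + j) ` Poly_Mapping.keys p)"
    unfolding total_degree_def by (rule Max_in) auto
  moreover obtain b where "b \<in> Poly_Mapping.keys p"
    using assms by (auto simp flip: keys_eq_empty)
  ultimately have "\<exists>a\<in>Poly_Mapping.keys p. fst a + snd a = total_degree p"
    using total_degree_ge[of b p] by (cases "total_degree p = 0") force+
  then have "T \<noteq> {}" unfolding T_def by blast
  moreover have fin: "finite T" by (simp add: T_def)
  ultimately have "Max (fst ` T) \<in> fst ` T"
    by (intro Max_in) auto
  then obtain a where aT: "a \<in> T" and a: "fst a = Max (fst ` T)"
    by (metis imageE)
  show thesis
  proof
    show "a \<in> Poly_Mapping.keys p" "fst a + snd a = total_degree p"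
      using aT by (simp_all add: T_def)
    fix a' assume "a' \<in> Poly_Mapping.keys p" "fst a' + snd a' = total_degree p"
    then have "a' \<in> T" by (simp add: T_def)
    then show "fst a' \<le> fst a" using a fin by simp
  qed
qed

text \<open>
  The product of the two leading monomials arises from no other pair of monomials, so its
  coefficient cannot cancel.
\<close>

lemma total_degree_times_ge:
  assumes "p \<noteq> 0" "q \<noteq> 0"
  shows "total_degree p + total_degree q \<le> total_degree (p * q)"
proof -
  obtain a where a: "a \<in> Poly_Mapping.keys p" "fst a + snd a = total_degree p"
    and amax: "\<And>a'. a' \<in> Poly_Mapping.keys p \<Longrightarrow> fst a' + snd a' = total_degree p \<Longrightarrow> fst a' \<le> fst a"
    using total_degree_leading_monomial[OF assms(1)] by blast
  obtain b where b: "b \<in> Poly_Mapping.keys q" "fst b + snd b = total_degree q"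
    and bmax: "\<And>b'. b' \<in> Poly_Mapping.keys q \<Longrightarrow> fst b' + snd b' = total_degree q \<Longrightarrow> fst b' \<le> fst b"
    using total_degree_leading_monomial[OF assms(2)] by blast
  have "a' = a \<and> b' = b"
    if "a' \<in> Poly_Mapping.keys p" "b' \<in> Poly_Mapping.keys q" "a' + b' = a + b" for a' b'
  proof -
    have s: "fst a' + fst b' = fst a + fst b" "snd a' + snd b' = snd a + snd b"
      using that(3) by (simp_all flip: fst_add snd_add)
    then have "fst a' + snd a' = total_degree p" "fst b' + snd b' = total_degree q"
      using total_degree_ge[OF that(1)] total_degree_ge[OF that(2)] a(2) b(2) by linarith+
    then show ?thesis
      using amax[OF that(1)] bmax[OF that(2)] s a(2) b(2) by (simp add: prod_eq_iff)
  qed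
  then have "{(a', b'). a' \<in> Poly_Mapping.keys p \<and> b' \<in> Poly_Mapping.keys q \<and> a' + b' = a + b} = {(a, b)}"
    using a(1) b(1) by blast
  then have "Poly_Mapping.lookup (p * q) (a + b) = Poly_Mapping.lookup p a * Poly_Mapping.lookup q b"
    by (simp add: lookup_times_expand)
  then have "a + b \<in> Poly_Mapping.keys (p * q)"
    using a(1) b(1) by (simp add: in_keys_iff)
  then show ?thesis
    using total_degree_ge[of "a + b" "p * q"] a(2) b(2) by simp
qed

lemma times_constant:
  assumes "total_degree q = 0"
  shows "Poly_Mapping.lookup (p * q) k = Poly_Mapping.lookup q 0 * Poly_Mapping.lookup p k"
proof -
  have "b = 0" if "b \<in> Poly_Mapping.keys q" for b
    using total_degree_ge[OF that] assms by (simp add: prod_eq_iff)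
  then have pairs: "a \<in> Poly_Mapping.keys p \<and> b \<in> Poly_Mapping.keys q \<and> a + b = k \<longleftrightarrow>
      k \<in> Poly_Mapping.keys p \<and> 0 \<in> Poly_Mapping.keys q \<and> a = k \<and> b = 0" for a b
    by (metis add.right_neutral)
  have "{(a, b). a \<in> Poly_Mapping.keys p \<and> b \<in> Poly_Mapping.keys q \<and> a + b = k}
      = (if k \<in> Poly_Mapping.keys p \<and> 0 \<in> Poly_Mapping.keys q then {(k, 0)} else {})"
    unfolding pairs by auto
  then show ?thesis
    by (auto simp: lookup_times_expand in_keys_iff)
qed

section \<open>Index types of sizes five and six\<close>

text \<open>
  The induction rule yields the representatives \<open>0, \<dots>, n - 1\<close>; the numeral \<open>n\<close> equals \<open>0\<close> in the type of size \<open>n\<close>.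
\<close>

lemma exhaust_5: fixes x :: 5 shows "x = 1 \<or> x = 2 \<or> x = 3 \<or> x = 4 \<or> x = 5"
proof (induct x)
  case (of_int z)
  then have "z = 0 \<or> z = 1 \<or> z = 2 \<or> z = 3 \<or> z = 4" by fastforce
  then show ?case by auto
qed

lemma exhaust_6: fixes x :: 6 shows "x = 1 \<or> x = 2 \<or> x = 3 \<or> x = 4 \<or> x = 5 \<or> x = 6"
proof (induct x)
  case (of_int z)
  then have "z = 0 \<or> z = 1 \<or> z = 2 \<or> z = 3 \<or> z = 4 \<or> z = 5" by fastforce
  then show ?case by auto
qed

lemma sum_6: "sum f (UNIV::6 set) = f 1 + f 2 + f 3 + f 4 + f 5 + f 6"
proof -
  have UNIV_6: "UNIV = {1, 2, 3, 4, 5, 6::6}" using exhaust_6 by auto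
  show ?thesis unfolding UNIV_6 by (simp add: ac_simps)
qed

lemma vector_5:
  "(vector [a,b,c,d,e] ::('a::zero)^5)$1 = a"
  "(vector [a,b,c,d,e] ::('a::zero)^5)$2 = b"
  "(vector [a,b,c,d,e] ::('a::zero)^5)$3 = c"
  "(vector [a,b,c,d,e] ::('a::zero)^5)$4 = d"
  "(vector [a,b,c,d,e] ::('a::zero)^5)$5 = e"
  unfolding vector_def by simp_all

lemma vector_6:
  "(vector [a,b,c,d,e,f] ::('a::zero)^6)$1 = a"
  "(vector [a,b,c,d,e,f] ::('a::zero)^6)$2 = b"
  "(vector [a,b,c,d,e,f] ::('a::zero)^6)$3 = c"
  "(vector [a,b,c,d,e,f] ::('a::zero)^6)$4 = d"
  "(vector [a,b,c,d,e,f] ::('a::zero)^6)$5 = e"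
  "(vector [a,b,c,d,e,f] ::('a::zero)^6)$6 = f"
  unfolding vector_def by simp_all

lemma det_compression_23456:
  assumes "invertible A"
  shows "det (compression_23456 A) = matrix_inv A $ 1 $ 1 * det A"
proof -
  define s :: "5 \<Rightarrow> 6" where "s = (\<lambda>i. vector [2, 3, 4, 5, 6] $ i)"
  have s: "s 1 = 2" "s 2 = 3" "s 3 = 4" "s 4 = 5" "s 5 = 6"
    by (simp_all add: s_def vector_5)
  have inj: "inj s"
  proof (rule injI)
    fix i j assume "s i = s j"
    then show "i = j" using exhaust_5[of i] exhaust_5[of j] s by auto
  qed
  have ran: "range s = - {1}"
  proof (intro set_eqI iffI)
    fix k assume "k \<in> range s"
    then obtain i where "k = s i" by blast
    then show "k \<in> - {1}" using exhaust_5[of i] s by auto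
  next
    fix k :: 6 assume "k \<in> - {1}"
    then show "k \<in> range s" using exhaust_6[of k] s by (metis ComplD insertI1 rangeI)
  qed
  show ?thesis
    using det_principal_compression[OF assms inj ran]
    by (simp add: compression_23456_def s_def Let_def)
qed

section \<open>Recursive generation from a single quadratic relation\<close>

lemmas column_labels =
  vector_6[of "(0, 0) :: nat \<times> nat" "(1, 0)" "(0, 1)" "(2, 0)" "(1, 1)" "(0, 2)", folded column_label_def]

lemma exponents_of_degree_le_2:
  assumes "i + j \<le> 2"
  shows "(i, j) \<in> range column_label"
proof -
  have "(i, j) \<in> {(0, 0), (1, 0), (0, 1), (2, 0), (1, 1), (0, 2)}"
    using assms by (cases i; cases j) (auto simp: numeral_2_eq_2)
  then show ?thesis
    unfolding column_labels[symmetric] by blast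
qed

lemma column_combination_eq:
  "column_combination A p = A *v (\<chi> k. Poly_Mapping.lookup p (column_label k))"
  by (simp add: column_combination_def matrix_mult_sum scalar_mult_eq_scaleR)

text \<open>
  The entries \<open>4, 5, 6\<close> of \<open>c\<close> are the coefficients of \<open>x\<^sup>2, xy, y\<^sup>2\<close>. Hence a nonzero column relation
  has degree two, and a factor \<open>q\<close> that keeps the degree at most two must be constant.
\<close>

lemma recursively_generated_if_kernel_quadratic:
  assumes ker: "\<And>x. A *v x = 0 \<Longrightarrow> x \<in> span {c}"
    and c: "c $ 4 \<noteq> 0 \<or> c $ 5 \<noteq> 0 \<or> c $ 6 \<noteq> 0"
  shows "recursively_generated A"
  unfolding recursively_generated_def
proof (intro allI impI)
  fix p q :: bipoly
  assume p2: "total_degree p \<le> 2" and p0: "column_combination A p = 0"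
    and pq2: "total_degree (p * q) \<le> 2"
  define v :: "real^6" where "v = (\<chi> k. Poly_Mapping.lookup p (column_label k))"
  show "column_combination A (p * q) = 0"
  proof (cases "p = 0 \<or> q = 0")
    case True
    then show ?thesis by (auto simp: column_combination_def)
  next
    case False
    obtain r where r: "v = r *\<^sub>R c"
      using ker[of v] p0 by (auto simp: column_combination_eq v_def span_singleton)
    \<comment> \<open>Polynomials of degree at most two are determined by their six column coefficients.\<close>
    have "r \<noteq> 0"
    proof
      assume "r = 0"
      obtain i j where ij: "(i, j) \<in> Poly_Mapping.keys p"
        using False by (metis keys_eq_empty ex_in_conv surj_pair)
      then have "i + j \<le> 2" using total_degree_ge[OF ij] p2 by simp
      then obtain k where "(i, j) = column_label k"
        using exponents_of_degree_le_2 by blast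
      then have "v $ k \<noteq> 0" using ij by (simp add: v_def in_keys_iff)
      then show False using r \<open>r = 0\<close> by simp
    qed
    have "v $ 4 \<noteq> 0 \<or> v $ 5 \<noteq> 0 \<or> v $ 6 \<noteq> 0"
      using c \<open>r \<noteq> 0\<close> by (simp add: r)
    then have "(2, 0) \<in> Poly_Mapping.keys p \<or> (1, 1) \<in> Poly_Mapping.keys p \<or> (0, 2) \<in> Poly_Mapping.keys p"
      by (simp add: v_def column_labels in_keys_iff)
    then have "2 \<le> total_degree p"
      using total_degree_ge[of _ p] by fastforce
    then have "total_degree q = 0"
      using total_degree_times_ge[of p q] False pq2 by simp
    then have "column_combination A (p * q) = Poly_Mapping.lookup q 0 *\<^sub>R column_combination A p"
      by (simp add: column_combination_def times_constant scaleR_sum_right)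
    then show ?thesis by (simp add: p0)
  qed
qed

section \<open>The perturbed moment matrix\<close>

lemma E11_mult_vector: "E11 *v x = x $ 1 *\<^sub>R axis 1 1"
proof -
  have "(E11 *v x) $ i = (x $ 1 *\<^sub>R axis 1 1) $ i" for i
    by (cases "i = 1") (simp_all add: matrix_vector_mult_def E11_def axis_def if_distrib
        if_distribR cong: if_cong)
  then show ?thesis by (simp add: vec_eq_iff)
qed

text \<open>
  If \<open>c\<close> had degree at most one, rows \<open>1, 2, 3\<close> of the system would make it the constant \<open>1\<close>, but
  row \<open>4\<close> has right-hand side \<open>0\<close> and leading entry \<open>1\<close>.
\<close>

lemma inverse_column_quadratic:
  fixes c :: "real^6"
  assumes "moment_matrix2 \<beta>30 \<beta>21 \<beta>12 \<beta>03 \<beta>40 \<beta>31 \<beta>22 \<beta>13 \<beta>04 *v c = axis 1 1" (is "?M *v c = _")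
  shows "c $ 4 \<noteq> 0 \<or> c $ 5 \<noteq> 0 \<or> c $ 6 \<noteq> 0"
proof (rule ccontr)
  assume "\<not> ?thesis"
  then have z: "c $ 4 = 0" "c $ 5 = 0" "c $ 6 = 0" by auto
  have row: "(\<Sum>j\<in>UNIV. ?M $ i $ j * c $ j) = axis 1 1 $ i" for i
    using arg_cong[OF assms, of "\<lambda>v. v $ i"] by (simp add: matrix_vector_mult_def)
  have "c $ 1 = 1" "c $ 2 = 0" "c $ 3 = 0"
    using row[of 1] row[of 2] row[of 3]
    by (simp_all add: sum_6 moment_matrix2_def vector_6 axis_def z)
  moreover have "c $ 1 + \<beta>30 * c $ 2 + \<beta>21 * c $ 3 = 0"
    using row[of 4] by (simp add: sum_6 moment_matrix2_def vector_6 axis_def z)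
  ultimately show False by simp
qed

theorem proposition3p2:
  fixes \<beta>30 \<beta>21 \<beta>12 \<beta>03 \<beta>40 \<beta>31 \<beta>22 \<beta>13 \<beta>04 :: real
    and M R :: "real^6^6" and Mhat :: "real \<Rightarrow> real^6^6" and u0 :: real
  assumes M: "M = moment_matrix2 \<beta>30 \<beta>21 \<beta>12 \<beta>03 \<beta>40 \<beta>31 \<beta>22 \<beta>13 \<beta>04"
    and psd: "positive_semidefinite M"
    and inv: "invertible M"
    and Mhat: "Mhat = (\<lambda>u. M - u *\<^sub>R E11)"
    and R: "R = matrix_inv M"
    and u0: "u0 = 1 / R $ 1 $ 1"
  shows "R $ 1 $ 1 \<noteq> 0 \<and> det (compression_23456 M) \<noteq> 0 \<and>
     u0 = det M / det (compression_23456 M) \<and>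
     u0 \<ge> 0 \<and>
     positive_semidefinite (Mhat u0) \<and>
     rank (Mhat u0) = 5 \<and>
     recursively_generated (Mhat u0) \<and>
     (\<forall>u. positive_semidefinite (Mhat u) \<and> rank (Mhat u) = 5 \<and> recursively_generated (Mhat u)
        \<longrightarrow> u = u0)"
proof -
  define c where "c = matrix_inv M *v axis 1 1"
  have c: "M *v c = axis 1 1"
    unfolding c_def using inv by (rule matrix_vector_mult_matrix_inv)
  have c1: "c $ 1 = R $ 1 $ 1"
    by (simp add: c_def R matrix_vector_mult_basis column_def)
  have R11: "0 < R $ 1 $ 1"
    using psd_inverse_diagonal_pos[OF psd c] by (simp add: c1)
  have detM: "det M \<noteq> 0"
    using inv by (simp add: invertible_det_nz)
  have minor: "det (compression_23456 M) = R $ 1 $ 1 * det M"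
    using det_compression_23456[OF inv] by (simp add: R)
  have mult: "Mhat u *v x = M *v x - (u * x $ 1) *\<^sub>R axis 1 1" for u x
    by (simp add: Mhat matrix_vector_mult_diff_rdistrib scaleR_matrix_vector_assoc[symmetric] E11_mult_vector)
  have ker: "Mhat u *v x = 0 \<longleftrightarrow> x = 0 \<or> u = u0 \<and> x \<in> span {c}" for u x
    using kernel_diagonal_perturbation[OF inv c, of x u] R11 by (simp add: mult c1 u0)

  have "positive_semidefinite (Mhat u0)"
    unfolding positive_semidefinite_def
  proof (intro conjI allI)
    have "transpose M = M" using psd by (simp only: positive_semidefinite_def)
    then have "M $ i $ j = M $ j $ i" for i j
      by (simp add: transpose_def vec_eq_iff)
    then show "transpose (Mhat u0) = Mhat u0"
      by (auto simp: vec_eq_iff transpose_def Mhat E11_def)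
  next
    fix x
    show "0 \<le> x \<bullet> (Mhat u0 *v x)"
      using psd_quadratic_form_ge[OF psd c, of x]
      by (simp add: mult inner_diff_right inner_axis c1 u0 power2_eq_square)
  qed
  moreover have "rank (Mhat u0) = 5"
  proof -
    have "{x. Mhat u0 *v x = 0} = span {c}"
      using ker[of u0] by (auto simp: span_zero)
    moreover have "c \<noteq> 0" using c1 R11 by auto
    ultimately show ?thesis
      using rank_plus_nullity[of "Mhat u0"] by simp
  qed
  moreover have "recursively_generated (Mhat u0)"
    using ker[of u0] inverse_column_quadratic c
    by (intro recursively_generated_if_kernel_quadratic[of _ c]) (auto simp: M span_zero)
  moreover have "u = u0" if "rank (Mhat u) = 5" for u
  proof (rule ccontr)
    assume "u \<noteq> u0"
    then have "{x. Mhat u *v x = 0} = {0}" using ker[of u] by auto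
    then show False
      using rank_plus_nullity[of "Mhat u"] that by simp
  qed
  moreover have "R $ 1 $ 1 \<noteq> 0" "det (compression_23456 M) \<noteq> 0"
    "u0 = det M / det (compression_23456 M)" "u0 \<ge> 0"
    using R11 detM by (simp_all add: minor u0)
  ultimately show ?thesis by blast
qed

end
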